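(* Let $(\phi_t)$ be a parabolic semigroup of zero hyperbolic step in $\mathbb{H}$ with Denjoy--Wolff point $\infty$ and infinitesimal generator $G\colon\mathbb{H}\to\mathbb{H}$. Then $(\phi_t)$ is of extremal rate if and only if $\angle\lim_{z\to\infty}zG(z)\in(-\infty,0)$. Moreover, in that case, for all $z\in\mathbb{H}$, $$\lim_{t\to+\infty}\frac{|\phi_t(z)|}{\sqrt t}=\sqrt{-2\,\angle\lim_{w\to\infty}wG(w)}.$$
   Context: $\mathbb{H}$ is the upper half-plane. A semigroup in $\mathbb{H}$ is a family $(\phi_t)_{t\ge0}$ of holomorphic self-maps of $\mathbb{H}$ with $\phi_0=\mathrm{id}$, $\phi_{t+s}=\phi_t\circ\phi_s$, and $\phi_t\to\mathrm{id}$ pointwise as $t\to0^+$; its infinitesimal generator $G$ satisfies $\partial_t\phi_t(z)=G(\phi_t(z))$. Non-elliptic: no fixed points of $\phi_t$, $t>0$, in $\mathbb{H}$; orbits then converge to a common boundary point (Denjoy--Wolff point). With Denjoy--Wolff point $\infty$, parabolic means $\angle\lim_{z\to\infty}\phi_t(z)/z=1$; zero hyperbolic step means $d_{\mathbb{H}}(\phi_{t+1}(z),\phi_t(z))\to0$ as $t\to+\infty$ ($d_{\mathbb{H}}$ hyperbolic distance). Extremal rate: there is $L\in(0,+\infty)$ with $\lim_{t\to+\infty}|\phi_t(z)|/\sqrt t=L$ for all $z$. The angular limit $\angle\lim_{z\to\infty}f(z)=\ell$ means $f(z)\to\ell$ as $z\to\infty$ within every sector $\{z\in\mathbb{H}:|\arg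 z-\pi/2|<\theta\}$, $\theta\in(0,\pi/2)$. *)

theory Defs
  imports "HOL-Complex_Analysis.Complex_Analysis"
begin

definition upper_half_plane :: "complex set" where
  "upper_half_plane = {z. Im z > 0}"

definition is_semigroup_H :: "(real \<Rightarrow> complex \<Rightarrow> complex) \<Rightarrow> bool" where
  "is_semigroup_H \<phi> \<longleftrightarrow>
     (\<forall>t\<ge>0. \<phi> t holomorphic_on upper_half_plane \<and> \<phi> t ` upper_half_plane \<subseteq> upper_half_plane) \<and>
     (\<forall>z\<in>upper_half_plane. \<phi> 0 z = z) \<and>
     (\<forall>t\<ge>0. \<forall>s\<ge>0. \<forall>z\<in>upper_half_plane. \<phi> (t + s) z = \<phi> t (\<phi> s z)) \<and>
     (\<forall>z\<in>upper_half_plane. ((\<lambda>t. \<phi> t z) \<longlongrightarrow> z) (at_right 0))"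

definition is_generator_H :: "(real \<Rightarrow> complex \<Rightarrow> complex) \<Rightarrow> (complex \<Rightarrow> complex) \<Rightarrow> bool" where
  "is_generator_H \<phi> G \<longleftrightarrow>
     G holomorphic_on upper_half_plane \<and>
     (\<forall>z\<in>upper_half_plane. \<forall>t\<ge>0.
        ((\<lambda>s. \<phi> s z) has_vector_derivative G (\<phi> t z)) (at t within {0..}))"

definition non_elliptic_DW_infty :: "(real \<Rightarrow> complex \<Rightarrow> complex) \<Rightarrow> bool" where
  "non_elliptic_DW_infty \<phi> \<longleftrightarrow>
     (\<forall>t>0. \<forall>z\<in>upper_half_plane. \<phi> t z \<noteq> z) \<and>
     (\<forall>z\<in>upper_half_plane. filterlim (\<lambda>t. \<phi> t z) at_infinity at_top)"

definition sector_H :: "real \<Rightarrow> complex set" where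
  "sector_H \<theta> = {z. Im z > 0 \<and> \<bar>Arg z - pi / 2\<bar> < \<theta>}"

definition angular_lim_infty :: "(complex \<Rightarrow> complex) \<Rightarrow> complex \<Rightarrow> bool" where
  "angular_lim_infty f l \<longleftrightarrow>
     (\<forall>\<theta>. 0 < \<theta> \<and> \<theta> < pi / 2 \<longrightarrow> (f \<longlongrightarrow> l) (inf at_infinity (principal (sector_H \<theta>))))"

definition parabolic_H :: "(real \<Rightarrow> complex \<Rightarrow> complex) \<Rightarrow> bool" where
  "parabolic_H \<phi> \<longleftrightarrow> (\<forall>t\<ge>0. angular_lim_infty (\<lambda>z. \<phi> t z / z) 1)"

definition hyp_dist_H :: "complex \<Rightarrow> complex \<Rightarrow> real" where
  "hyp_dist_H z w = 2 * artanh (cmod (z - w) / cmod (z - cnj w))"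

definition zero_hyperbolic_step :: "(real \<Rightarrow> complex \<Rightarrow> complex) \<Rightarrow> bool" where
  "zero_hyperbolic_step \<phi> \<longleftrightarrow>
     (\<forall>z\<in>upper_half_plane. ((\<lambda>t. hyp_dist_H (\<phi> (t + 1) z) (\<phi> t z)) \<longlongrightarrow> 0) at_top)"

definition extremal_rate :: "(real \<Rightarrow> complex \<Rightarrow> complex) \<Rightarrow> bool" where
  "extremal_rate \<phi> \<longleftrightarrow>
     (\<exists>L>0. \<forall>z\<in>upper_half_plane. ((\<lambda>t. cmod (\<phi> t z) / sqrt t) \<longlongrightarrow> L) at_top)"

end

theory Submission
  imports Defs
begin

text \<open>
  If \<open>z G z \<rightarrow> L < 0\<close> angularly, then \<open>w\<^sup>2\<close> has derivative \<open>2 w G w\<close> along an orbit \<open>w\<close>. For a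
  starting point high on the imaginary axis this keeps the orbit in a cone, and by Schwarz--Pick
  every other orbit stays at bounded hyperbolic distance from it, hence in a wider cone. There
  \<open>2 w G w \<rightarrow> 2 L\<close>, so \<open>w\<^sup>2 / t \<rightarrow> 2 L\<close>.

  Conversely, parabolicity and Julia's lemma give \<open>Im (\<phi> t z) \<ge> Im z\<close>, so \<open>G\<close> and \<open>F = -1/G\<close> map
  the half-plane to itself unless \<open>G\<close> is constant. By Julia--Wolff--Caratheodory
  \<open>F z / z \<rightarrow> a \<ge> 0\<close> angularly, and \<open>z G z \<rightarrow> -1/a\<close> if \<open>a > 0\<close>. If \<open>a = 0\<close>, let \<open>h\<close> be the
  Koenigs function, \<open>h' = 1/G = -F\<close>. Then \<open>h z = o(z\<^sup>2)\<close> in cones, and \<open>Re h\<close> increases along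
  upward vertical rays because \<open>Im F > 0\<close>, so \<open>Re (h z) \<le> o(\<bar>z\<bar>\<^sup>2)\<close> without angular restriction.
  Since \<open>h (\<phi> t z) = h z + t\<close>, this forces \<open>\<bar>\<phi> t z\<bar>\<^sup>2 / t \<rightarrow> \<infinity>\<close>.
\<close>

section \<open>Stolz cones\<close>

text \<open>Sectors rewritten with a slope in place of an angle: linear inequalities between
  \<open>Re\<close> and \<open>Im\<close> are easier to carry along orbits and through estimates
  than bounds on \<open>Arg\<close>.\<close>

definition cone_H :: "real \<Rightarrow> complex set" where
  "cone_H k = {z. 0 < Im z \<and> \<bar>Re z\<bar> \<le> k * Im z}"

lemma Im_pos_of_cone_H: "z \<in> cone_H k \<Longrightarrow> 0 < Im z"
  by (simp add: cone_H_def)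

text \<open>With \<open>u = Arg z - pi / 2\<close>, the quotient of \<open>\<bar>Re z\<bar>\<close>
  by \<open>Im z\<close> is the tangent of \<open>\<bar>u\<bar>\<close>, and the tangent is
  increasing on the relevant interval.\<close>

lemma sector_H_iff:
  assumes "0 < Im z" "0 < \<theta>" "\<theta> < pi / 2"
  shows "z \<in> sector_H \<theta> \<longleftrightarrow> \<bar>Re z\<bar> < tan \<theta> * Im z"
proof -
  define u where "u = Arg z - pi / 2"
  have u: "- (pi / 2) < u" "u < pi / 2"
    using Arg_lt_pi[of z] assms(1) by (auto simp: u_def)
  have Arg: "Arg z = pi / 2 + u" by (simp add: u_def)
  have z: "z = rcis (cmod z) (Arg z)" by (simp add: rcis_cmod_Arg)
  have Re: "Re z = - cmod z * sin u"
    by (subst z) (simp add: Arg cos_add)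
  have Im: "Im z = cmod z * cos u"
    by (subst z) (simp add: Arg sin_add)
  have cu: "0 < cos u" using u by (simp add: cos_gt_zero_pi)
  have "0 < cmod z" using assms(1) by auto
  have abs_tan: "\<bar>tan u\<bar> = tan \<bar>u\<bar>"
  proof (cases "u \<ge> 0")
    case True
    then have "0 \<le> tan u" using u by (metis tan_gt_zero tan_zero less_eq_real_def)
    with True show ?thesis by simp
  next
    case False
    then have "tan (-u) > 0" using u by (intro tan_gt_zero) auto
    with False show ?thesis by simp
  qed
  have "\<bar>Re z\<bar> = tan \<bar>u\<bar> * Im z"
    using cu unfolding Re Im abs_tan[symmetric] by (simp add: tan_def abs_mult)
  then have "\<bar>Re z\<bar> < tan \<theta> * Im z \<longleftrightarrow> tan \<bar>u\<bar> < tan \<theta>"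
    using assms(1) by simp
  also have "\<dots> \<longleftrightarrow> \<bar>u\<bar> < \<theta>"
    using u assms by (intro tan_mono_lt_eq) auto
  finally show ?thesis using assms(1) by (simp add: sector_H_def u_def)
qed

lemma angular_lim_infty_iff_cone:
  "angular_lim_infty f l \<longleftrightarrow>
     (\<forall>k>0. (f \<longlongrightarrow> l) (inf at_infinity (principal (cone_H k))))"
  (is "_ \<longleftrightarrow> ?C")
proof
  assume L: "angular_lim_infty f l"
  show ?C
  proof (intro allI impI)
    fix k :: real assume k: "0 < k"
    \<comment> \<open>The cone is closed and the sector open, so the slope is enlarged from
      \<open>k\<close> to \<open>k + 1\<close>.\<close>
    let ?t = "arctan (k + 1)"
    have t: "0 < ?t" "?t < pi / 2"
      using k arctan_ubound by (auto simp: zero_less_arctan_iff)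
    have "cone_H k \<subseteq> sector_H ?t"
    proof
      fix z assume z: "z \<in> cone_H k"
      then have "k * Im z < (k + 1) * Im z" by (simp add: cone_H_def)
      then have "\<bar>Re z\<bar> < (k + 1) * Im z" "0 < Im z"
        using z by (auto simp: cone_H_def algebra_simps)
      with t show "z \<in> sector_H ?t"
        by (subst sector_H_iff) (simp_all add: tan_arctan)
    qed
    then have "inf at_infinity (principal (cone_H k)) \<le> inf at_infinity (principal (sector_H ?t))"
      by (intro inf_mono) auto
    moreover have "(f \<longlongrightarrow> l) (inf at_infinity (principal (sector_H ?t)))"
      using L t by (simp add: angular_lim_infty_def)
    ultimately show "(f \<longlongrightarrow> l) (inf at_infinity (principal (cone_H k)))"
      by (rule tendsto_mono)
  qed
next
  assume C: ?C
  show "angular_lim_infty f l"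
    unfolding angular_lim_infty_def
  proof (intro allI impI)
    fix \<theta> :: real assume \<theta>: "0 < \<theta> \<and> \<theta> < pi / 2"
    have "sector_H \<theta> \<subseteq> cone_H (tan \<theta>)"
    proof
      fix z assume z: "z \<in> sector_H \<theta>"
      then have "0 < Im z" by (simp add: sector_H_def)
      with z \<theta> show "z \<in> cone_H (tan \<theta>)"
        using sector_H_iff[of z \<theta>] by (simp add: cone_H_def)
    qed
    then have "inf at_infinity (principal (sector_H \<theta>)) \<le> inf at_infinity (principal (cone_H (tan \<theta>)))"
      by (intro inf_mono) auto
    moreover have "(f \<longlongrightarrow> l) (inf at_infinity (principal (cone_H (tan \<theta>))))"
      using C \<theta> by (simp add: tan_gt_zero)
    ultimately show "(f \<longlongrightarrow> l) (inf at_infinity (principal (sector_H \<theta>)))"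
      by (rule tendsto_mono)
  qed
qed

lemma angular_lim_inftyD:
  assumes "angular_lim_infty f l" "0 < k" "0 < e"
  obtains R where "\<And>z. z \<in> cone_H k \<Longrightarrow> R \<le> cmod z \<Longrightarrow> cmod (f z - l) < e"
proof -
  have "(f \<longlongrightarrow> l) (inf at_infinity (principal (cone_H k)))"
    using assms by (simp add: angular_lim_infty_iff_cone)
  then have "eventually (\<lambda>z. dist (f z) l < e) (inf at_infinity (principal (cone_H k)))"
    using assms(3) by (rule tendstoD)
  then obtain R where "\<forall>z. R \<le> norm z \<longrightarrow> z \<in> cone_H k \<longrightarrow> dist (f z) l < e"
    unfolding eventually_inf_principal eventually_at_infinity by blast
  then show thesis by (intro that[of R]) (simp add: dist_norm)
qed

lemma angular_lim_inftyI:
  assumes "\<And>k e. 0 < k \<Longrightarrow> 0 < e \<Longrightarrow>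
             \<exists>R. \<forall>z\<in>cone_H k. R \<le> cmod z \<longrightarrow> cmod (f z - l) < e"
  shows "angular_lim_infty f l"
  unfolding angular_lim_infty_iff_cone
proof (intro allI impI tendstoI)
  fix k e :: real assume "0 < k" "0 < e"
  then obtain R where "\<forall>z\<in>cone_H k. R \<le> cmod z \<longrightarrow> cmod (f z - l) < e"
    using assms by blast
  then show "eventually (\<lambda>z. dist (f z) l < e) (inf at_infinity (principal (cone_H k)))"
    unfolding eventually_inf_principal eventually_at_infinity dist_norm by blast
qed

lemma angular_lim_infty_unique:
  assumes "angular_lim_infty f l" "angular_lim_infty f m"
  shows "l = m"
proof (rule ccontr)
  assume "l \<noteq> m"
  then have e: "0 < cmod (l - m) / 2" by simp
  obtain R where R: "\<And>z. z \<in> cone_H 1 \<Longrightarrow> R \<le> cmod z \<Longrightarrow> cmod (f z - l) < cmod (l - m) / 2"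
    using angular_lim_inftyD[OF assms(1) zero_less_one e] by blast
  obtain S where S: "\<And>z. z \<in> cone_H 1 \<Longrightarrow> S \<le> cmod z \<Longrightarrow> cmod (f z - m) < cmod (l - m) / 2"
    using angular_lim_inftyD[OF assms(2) zero_less_one e] by blast
  \<comment> \<open>The imaginary axis lies in every cone, so a point of it beyond both radii
    compares the two limits.\<close>
  define z where "z = \<i> * of_real (\<bar>R\<bar> + \<bar>S\<bar> + 1)"
  have "z \<in> cone_H 1" by (simp add: z_def cone_H_def)
  moreover have "cmod z = \<bar>R\<bar> + \<bar>S\<bar> + 1" by (simp add: z_def norm_mult del: of_real_add)
  ultimately have "cmod (f z - l) < cmod (l - m) / 2" "cmod (f z - m) < cmod (l - m) / 2"
    using R S by auto
  moreover have "cmod (l - m) \<le> cmod (f z - m) + cmod (f z - l)"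
    using norm_triangle_ineq4[of "f z - m" "f z - l"] by (simp add: algebra_simps)
  ultimately show False by simp
qed

section \<open>The Schwarz--Pick inequality and the Julia--Wolff--Caratheodory theorem\<close>

lemma open_upper_half_plane: "open upper_half_plane"
  and convex_upper_half_plane: "convex upper_half_plane"
  by (simp_all add: upper_half_plane_def open_halfspace_Im_gt convex_halfspace_Im_gt)

text \<open>Removes the conjugate from the pseudo-hyperbolic distance
  \<open>cmod (z - w) / cmod (z - cnj w)\<close>, and shows that it is below 1 for two points of the
  half-plane.\<close>

lemma cmod_diff_cnj_squared: "(cmod (z - cnj w))\<^sup>2 = (cmod (z - w))\<^sup>2 + 4 * Im z * Im w"
  unfolding cmod_power2 by (simp add: power2_eq_square algebra_simps)

text \<open>Cayley transforms reduce this to the Schwarz lemma on the disc. The product form avoids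
  quotients, so it survives the limit to maps whose imaginary part may vanish.\<close>

lemma Schwarz_Pick_upper_half_plane:
  assumes hol: "f holomorphic_on upper_half_plane"
    and im: "\<And>z. 0 < Im z \<Longrightarrow> 0 < Im (f z)"
    and z: "0 < Im z" and w: "0 < Im w"
  shows "(cmod (f z - f w))\<^sup>2 * (Im z * Im w) \<le> (cmod (z - w))\<^sup>2 * (Im (f z) * Im (f w))"
proof -
  \<comment> \<open>\<open>A\<close> carries the unit disc to the half-plane with
    \<open>A 0 = w\<close>; \<open>B\<close> carries the half-plane to the disc and
    \<open>f w\<close> to 0. Below, \<open>\<xi>\<close> is the preimage of \<open>z\<close> under
    \<open>A\<close>.\<close>
  define A where "A \<zeta> = (w - cnj w * \<zeta>) / (1 - \<zeta>)" for \<zeta>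
  define B where "B u = (u - f w) / (u - cnj (f w))" for u
  have ww: "w - cnj w \<noteq> 0" using w by (simp add: complex_eq_iff)
  have nz: "u - cnj v \<noteq> 0" if "0 < Im u" "0 < Im v" for u v
    using that by (auto simp: complex_eq_iff)
  have A_pos: "0 < Im (A \<zeta>)" if \<zeta>: "cmod \<zeta> < 1" for \<zeta>
  proof -
    have [simp]: "\<zeta> \<noteq> 1" using \<zeta> by auto
    have 1: "A \<zeta> - w = \<zeta> * (A \<zeta> - cnj w)" and 2: "A \<zeta> - cnj w = (w - cnj w) / (1 - \<zeta>)"
      by (simp_all add: A_def divide_simps) (simp_all add: algebra_simps)
    have "A \<zeta> - cnj w \<noteq> 0" using ww by (simp add: 2)
    then have "cmod (A \<zeta> - w) < cmod (A \<zeta> - cnj w)"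
      using \<zeta> by (subst 1) (simp add: norm_mult)
    then have "(cmod (A \<zeta> - w))\<^sup>2 < (cmod (A \<zeta> - cnj w))\<^sup>2"
      by (simp add: power_strict_mono)
    then show ?thesis using w by (simp add: cmod_diff_cnj_squared zero_less_mult_iff)
  qed
  have B_lt: "cmod (B u) < 1" if u: "0 < Im u" for u
  proof -
    have "(cmod (u - f w))\<^sup>2 < (cmod (u - cnj (f w)))\<^sup>2"
      using u im[OF w] by (simp add: cmod_diff_cnj_squared)
    then have "cmod (u - f w) < cmod (u - cnj (f w))"
      by (rule power_less_imp_less_base) simp
    then show ?thesis using nz[OF u im[OF w]] by (simp add: B_def norm_divide divide_simps)
  qed
  define g where "g = (\<lambda>\<zeta>. B (f (A \<zeta>)))"
  have holA: "A holomorphic_on ball 0 1"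
    unfolding A_def by (intro holomorphic_intros) auto
  have holfA: "(\<lambda>\<zeta>. f (A \<zeta>)) holomorphic_on ball 0 1"
    using A_pos
    by (intro holomorphic_on_compose_gen[OF holA hol, unfolded o_def])
       (auto simp: upper_half_plane_def)
  have holg: "g holomorphic_on ball 0 1"
    unfolding g_def B_def
    by (intro holomorphic_intros holfA nz im A_pos w) auto
  have g0: "g 0 = 0" by (simp add: g_def A_def B_def)
  have g1: "cmod (g \<zeta>) < 1" if "cmod \<zeta> < 1" for \<zeta>
    using that by (simp add: g_def B_lt im A_pos)
  define \<xi> where "\<xi> = (z - w) / (z - cnj w)"
  have zw: "z - cnj w \<noteq> 0" using nz z w by blast
  have "(cmod (z - w))\<^sup>2 < (cmod (z - cnj w))\<^sup>2"
    using z w by (simp add: cmod_diff_cnj_squared)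
  then have "cmod (z - w) < cmod (z - cnj w)"
    by (rule power_less_imp_less_base) simp
  then have \<xi>1: "cmod \<xi> < 1" using zw by (simp add: \<xi>_def norm_divide divide_simps)
  have "1 - \<xi> = (w - cnj w) / (z - cnj w)" "w - cnj w * \<xi> = z * (w - cnj w) / (z - cnj w)"
    using zw by (simp_all add: \<xi>_def divide_simps) (simp_all add: algebra_simps)
  then have A\<xi>: "A \<xi> = z" using zw ww by (simp add: A_def)
  have "cmod (g \<xi>) \<le> cmod \<xi>"
    using Schwarz_Lemma(1)[OF holg g0 g1 \<xi>1] by simp
  then have "cmod ((f z - f w) / (f z - cnj (f w))) \<le> cmod \<xi>"
    by (simp only: g_def A\<xi> B_def)
  then have "cmod (f z - f w) * cmod (z - cnj w) \<le> cmod (z - w) * cmod (f z - cnj (f w))"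
    using zw nz[OF im[OF z] im[OF w]]
    by (simp add: \<xi>_def norm_divide divide_simps mult.commute split: if_splits)
  then have "(cmod (f z - f w) * cmod (z - cnj w))\<^sup>2 \<le> (cmod (z - w) * cmod (f z - cnj (f w)))\<^sup>2"
    by (rule power_mono) simp
  then have "(cmod (f z - f w))\<^sup>2 * ((cmod (z - w))\<^sup>2 + 4 * Im z * Im w)
      \<le> (cmod (z - w))\<^sup>2 * ((cmod (f z - f w))\<^sup>2 + 4 * Im (f z) * Im (f w))"
    by (simp only: power_mult_distrib cmod_diff_cnj_squared)
  then show ?thesis by (simp add: algebra_simps)
qed

text \<open>Adding \<open>\<i> * d\<close> with \<open>d > 0\<close> pushes the values into the open
  half-plane without changing differences; then \<open>d\<close> tends to 0.\<close>

lemma Schwarz_Pick_closed_upper_half_plane: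
  assumes hol: "f holomorphic_on upper_half_plane"
    and im: "\<And>z. 0 < Im z \<Longrightarrow> 0 \<le> Im (f z)"
    and z: "0 < Im z" and w: "0 < Im w"
  shows "(cmod (f z - f w))\<^sup>2 * (Im z * Im w) \<le> (cmod (z - w))\<^sup>2 * (Im (f z) * Im (f w))"
proof (rule tendsto_lowerbound)
  show "((\<lambda>d::real. (cmod (z - w))\<^sup>2 * ((Im (f z) + d) * (Im (f w) + d)))
          \<longlongrightarrow> (cmod (z - w))\<^sup>2 * (Im (f z) * Im (f w))) (at_right 0)"
    by (auto intro!: tendsto_eq_intros)
  have "(cmod (f z - f w))\<^sup>2 * (Im z * Im w) \<le> (cmod (z - w))\<^sup>2 * ((Im (f z) + d) * (Im (f w) + d))"
    if "0 < d" for d :: real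
    using Schwarz_Pick_upper_half_plane[of "\<lambda>z. f z + \<i> * of_real d" z w] hol im z w that
    by (simp add: holomorphic_intros add_nonneg_pos)
  then show "eventually (\<lambda>d. (cmod (f z - f w))\<^sup>2 * (Im z * Im w)
      \<le> (cmod (z - w))\<^sup>2 * ((Im (f z) + d) * (Im (f w) + d))) (at_right 0)"
    by (simp add: eventually_at_right_less eventually_mono[OF eventually_at_right_less])
qed simp

lemma cmod_le_of_cone_H:
  assumes "z \<in> cone_H k"
  shows "cmod z \<le> (1 + k) * Im z"
  using cmod_le[of z] assms by (auto simp: cone_H_def algebra_simps)

text \<open>Take \<open>a\<close> as the infimum of \<open>Im (f z) / Im z\<close>; then
  \<open>p z = f z - a * z\<close> has nonnegative imaginary part. Schwarz--Pick against a point
  \<open>z0\<close> where the infimum is nearly attained shows that \<open>p z\<close> is small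
  compared with \<open>z\<close> in each cone.\<close>

theorem Julia_Wolff_Caratheodory:
  assumes hol: "f holomorphic_on upper_half_plane"
    and im: "\<And>z. 0 < Im z \<Longrightarrow> 0 < Im (f z)"
  obtains a :: real where "0 \<le> a" "\<And>z. 0 < Im z \<Longrightarrow> a * Im z \<le> Im (f z)"
    "angular_lim_infty (\<lambda>z. f z / z) (of_real a)"
proof -
  define A where "A = (\<lambda>z. Im (f z) / Im z) ` {z. 0 < Im z}"
  define a where "a = Inf A"
  have A: "A \<noteq> {}" by (auto simp: A_def intro!: exI[of _ \<i>])
  have A0: "0 \<le> x" if "x \<in> A" for x
    using that im by (fastforce simp: A_def)
  then have bdd: "bdd_below A" by (rule bdd_belowI)
  have a0: "0 \<le> a" unfolding a_def using A A0 by (rule cInf_greatest)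
  have a_le: "a * Im z \<le> Im (f z)" if "0 < Im z" for z
  proof -
    have "a \<le> Im (f z) / Im z"
      unfolding a_def by (rule cInf_lower[OF _ bdd]) (use that in \<open>auto simp: A_def\<close>)
    then show ?thesis using that by (simp add: pos_le_divide_eq)
  qed
  define p where "p z = f z - of_real a * z" for z
  have holp: "p holomorphic_on upper_half_plane"
    unfolding p_def by (intro holomorphic_intros hol)
  have imp: "0 \<le> Im (p z)" if "0 < Im z" for z
    using a_le[OF that] by (simp add: p_def)
  have "angular_lim_infty (\<lambda>z. f z / z) (of_real a)"
  proof (rule angular_lim_inftyI)
    fix k e :: real assume k: "0 < k" and e: "0 < e"
    \<comment> \<open>Chosen so that \<open>4 * (1 + k) * d = e / 8\<close>, the factor in
      \<open>X2\<close>.\<close>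
    define d where "d = e / (32 * (1 + k))"
    have d: "0 < d" using k e by (simp add: d_def)
    have "Inf A < a + d" using d by (simp add: a_def)
    then obtain z0 where z0: "0 < Im z0" "Im (f z0) / Im z0 < a + d"
      using cInf_lessD[OF A] by (fastforce simp: A_def)
    have pz0: "Im (p z0) \<le> d * Im z0"
      using z0 by (simp add: p_def pos_divide_less_eq algebra_simps)
    show "\<exists>R. \<forall>z\<in>cone_H k. R \<le> cmod z \<longrightarrow> cmod (f z / z - of_real a) < e"
    proof (intro exI ballI impI)
      fix z assume zk: "z \<in> cone_H k" and zR: "4 * cmod (p z0) / e + cmod z0 + 1 \<le> cmod z"
      have z: "0 < Im z" using zk by (rule Im_pos_of_cone_H)
      have "0 \<le> 4 * cmod (p z0) / e" using e by simp
      then have zz0: "cmod z0 \<le> cmod z" "0 < cmod z" and "4 * cmod (p z0) / e \<le> cmod z"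
        using zR norm_ge_zero[of z0] by linarith+
      then have c0: "cmod (p z0) \<le> e * cmod z / 4"
        using e by (simp add: field_simps)
      define X where "X = cmod (p z - p z0)"
      have X0: "0 \<le> X" by (simp add: X_def)
      have "cmod (z - z0) \<le> 2 * cmod z"
        using norm_triangle_ineq4[of z z0] zz0 by simp
      then have "(cmod (z - z0))\<^sup>2 \<le> (2 * cmod z)\<^sup>2" by (rule power_mono) simp
      then have "(cmod (z - z0))\<^sup>2 * (Im (p z) * Im (p z0)) \<le> (2 * cmod z)\<^sup>2 * (Im (p z) * (d * Im z0))"
        using pz0 imp[OF z] imp[OF z0(1)] by (intro mult_mono) auto
      moreover have "X\<^sup>2 * (Im z * Im z0) \<le> (cmod (z - z0))\<^sup>2 * (Im (p z) * Im (p z0))"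
        unfolding X_def by (rule Schwarz_Pick_closed_upper_half_plane[OF holp imp z z0(1)])
      ultimately have "(X\<^sup>2 * Im z) * Im z0 \<le> (4 * (cmod z)\<^sup>2 * Im (p z) * d) * Im z0"
        by (simp add: power_mult_distrib mult_ac)
      then have XI: "X\<^sup>2 * Im z \<le> 4 * (cmod z)\<^sup>2 * Im (p z) * d"
        using z0(1) by simp
      \<comment> \<open>The cone enters here: \<open>Im z\<close> is bounded below by a multiple of
        \<open>cmod z\<close>, which turns \<open>XI\<close> into a bound without
        \<open>Im z\<close> on the left.\<close>
      have "X\<^sup>2 * cmod z \<le> X\<^sup>2 * ((1 + k) * Im z)"
        by (rule mult_left_mono[OF cmod_le_of_cone_H[OF zk]]) simp
      also have "\<dots> = (1 + k) * (X\<^sup>2 * Im z)" by simp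
      also have "\<dots> \<le> (1 + k) * (4 * (cmod z)\<^sup>2 * Im (p z) * d)"
        using XI k by (intro mult_left_mono) auto
      also have "\<dots> = (e / 8 * cmod z * Im (p z)) * cmod z"
        using k by (simp add: d_def power2_eq_square divide_simps)
      finally have X2: "X\<^sup>2 \<le> e / 8 * cmod z * Im (p z)"
        using zz0(2) by (simp add: mult_ac)
      \<comment> \<open>Otherwise \<open>X\<close> dominates \<open>cmod (p z0)\<close>, so
        \<open>Im (p z)\<close> is at most \<open>2 * X\<close>, and the quadratic bound
        \<open>X2\<close> forces \<open>X\<close> down to \<open>e * cmod z / 4\<close>.\<close>
      have "X < e * cmod z / 2"
      proof (rule ccontr)
        assume "\<not> X < e * cmod z / 2"
        then have big: "e * cmod z / 2 \<le> X" by simp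
        have ez: "0 < e * cmod z" using e zz0 by simp
        have "Im (p z) \<le> cmod (p z)" using abs_Im_le_cmod[of "p z"] by simp
        also have "\<dots> \<le> X + cmod (p z0)"
          unfolding X_def using norm_triangle_ineq2[of "p z" "p z0"] by simp
        also have "\<dots> \<le> 2 * X" using c0 big ez by simp
        finally have "e / 8 * cmod z * Im (p z) \<le> e / 8 * cmod z * (2 * X)"
          using ez by (intro mult_left_mono) auto
        with X2 have "X\<^sup>2 \<le> e / 8 * cmod z * (2 * X)" by (rule order_trans)
        then have "X * X \<le> (e * cmod z / 4) * X" by (simp add: power2_eq_square mult_ac)
        moreover have "0 < X" using big ez by linarith
        ultimately have "X \<le> e * cmod z / 4" by simp
        with big ez show False by simp
      qed
      moreover have "cmod (p z) \<le> X + cmod (p z0)"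
        unfolding X_def using norm_triangle_ineq2[of "p z" "p z0"] by simp
      moreover have "0 < e * cmod z" using e zz0 by simp
      ultimately have "cmod (p z) < e * cmod z" using c0 by linarith
      moreover have "f z / z - of_real a = p z / z"
        using zz0(2) by (simp add: p_def divide_simps)
      ultimately show "cmod (f z / z - of_real a) < e"
        using zz0(2) by (simp add: norm_divide divide_simps)
    qed
  qed
  with a0 a_le show thesis by (rule that)
qed


section \<open>Orbits in a cone\<close>

text \<open>L'Hopital's rule with denominator \<open>t\<close>, applied to real and imaginary parts.
  It serves for the square of an orbit, for the Koenigs function along an orbit, and for an orbit of
  a constant generator.\<close>

lemma tendsto_div_of_derivative_tendsto:
  fixes f f' :: "real \<Rightarrow> complex"
  assumes der: "\<And>t. 0 < t \<Longrightarrow> (f has_vector_derivative f' t) (at t)"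
    and lim: "(f' \<longlongrightarrow> c) at_top"
  shows "((\<lambda>t. f t / of_real t) \<longlongrightarrow> c) at_top"
proof -
  have *: "((\<lambda>t. g t / t) \<longlongrightarrow> d) at_top"
    if g: "\<And>t. 0 < t \<Longrightarrow> (g has_real_derivative g' t) (at t)" and g': "(g' \<longlongrightarrow> d) at_top"
    for g g' :: "real \<Rightarrow> real" and d
  proof (rule lhospital_at_top_at_top[where g' = "\<lambda>_. 1"])
    show "eventually (\<lambda>t. (g has_real_derivative g' t) (at t)) at_top"
      using g eventually_gt_at_top[of 0] by (rule eventually_mono[rotated])
  qed (use g' in \<open>auto simp: filterlim_ident\<close>)
  have "((\<lambda>t. Re (f t) / t) \<longlongrightarrow> Re c) at_top"
    by (rule *[OF _ tendsto_Re[OF lim]])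
       (auto simp: has_real_derivative_iff_has_vector_derivative
             intro!: bounded_linear.has_vector_derivative[OF bounded_linear_Re] der)
  moreover have "((\<lambda>t. Im (f t) / t) \<longlongrightarrow> Im c) at_top"
    by (rule *[OF _ tendsto_Im[OF lim]])
       (auto simp: has_real_derivative_iff_has_vector_derivative
             intro!: bounded_linear.has_vector_derivative[OF bounded_linear_Im] der)
  ultimately show ?thesis by (simp add: tendsto_complex_iff)
qed

text \<open>Staying in one cone turns the angular limit into a limit along the orbit. The square of
  \<open>w\<close> then has derivative tending to \<open>2 * L\<close>, and the rate is the square
  root of the modulus.\<close>

lemma orbit_rate:
  assumes der: "\<And>t. 0 < t \<Longrightarrow> (w has_vector_derivative G (w t)) (at t)"
    and inf: "filterlim w at_infinity at_top"
    and cone: "\<And>t. 0 \<le> t \<Longrightarrow> w t \<in> cone_H k" and "0 < k"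
    and lim: "angular_lim_infty (\<lambda>z. z * G z) (of_real L)" and "L < 0"
  shows "((\<lambda>t. cmod (w t) / sqrt t) \<longlongrightarrow> sqrt (- 2 * L)) at_top"
proof -
  have "filterlim w (inf at_infinity (principal (cone_H k))) at_top"
    using inf cone by (auto simp: filterlim_inf filterlim_principal
        intro: eventually_mono[OF eventually_ge_at_top[of 0]])
  then have "((\<lambda>t. w t * G (w t)) \<longlongrightarrow> of_real L) at_top"
    using lim \<open>0 < k\<close> by (auto simp: angular_lim_infty_iff_cone intro: filterlim_compose)
  then have "((\<lambda>t. w t * G (w t) + G (w t) * w t) \<longlongrightarrow> of_real (2 * L)) at_top"
    using tendsto_add by (fastforce simp: mult.commute)
  then have "((\<lambda>t. w t * w t / of_real t) \<longlongrightarrow> of_real (2 * L)) at_top"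
    by (rule tendsto_div_of_derivative_tendsto[rotated]) (intro has_vector_derivative_mult der)
  then have "((\<lambda>t. sqrt (cmod (w t * w t / of_real t))) \<longlongrightarrow> sqrt (cmod (of_real (2 * L)))) at_top"
    by (intro tendsto_intros)
  moreover have "eventually (\<lambda>t. sqrt (cmod (w t * w t / of_real t)) = cmod (w t) / sqrt t) at_top"
    using eventually_gt_at_top[of 0]
    by eventually_elim (simp add: norm_divide norm_mult real_sqrt_divide)
  ultimately have "((\<lambda>t. cmod (w t) / sqrt t) \<longlongrightarrow> sqrt (cmod (of_real (2 * L)))) at_top"
    by (rule Lim_transform_eventually)
  then show ?thesis using \<open>L < 0\<close> by (simp add: norm_mult abs_if)
qed

text \<open>First hitting time: before the least time \<open>s\<close> with
  \<open>c \<le> u s\<close> the function is below \<open>c\<close>, hence nonincreasing, so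
  \<open>u s \<le> u 0 < c\<close>.\<close>

lemma less_barrier:
  fixes u :: "real \<Rightarrow> real"
  assumes cont: "continuous_on {0..} u" and u0: "u 0 < c"
    and der: "\<And>t. 0 < t \<Longrightarrow> u t < c \<Longrightarrow> \<exists>d\<le>0. (u has_real_derivative d) (at t)"
    and t: "0 \<le> t"
  shows "u t < c"
proof (rule ccontr)
  assume nt: "\<not> u t < c"
  define S where "S = {s \<in> {0..t}. c \<le> u s}"
  have contt: "continuous_on {0..t} u"
    by (rule continuous_on_subset[OF cont]) auto
  have "closed S" unfolding S_def
    by (intro continuous_closed_preimage_constant continuous_on_closed_Collect_le continuous_on_const contt) auto
  moreover have "S \<subseteq> {0..t}" by (auto simp: S_def)
  ultimately have "compact S" by (metis bounded_subset compact_eq_bounded_closed box_real(2) bounded_cbox)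
  moreover have "t \<in> S" using t nt by (simp add: S_def)
  ultimately obtain s where s: "s \<in> S" and least: "\<And>r. r \<in> S \<Longrightarrow> s \<le> r"
    using compact_attains_inf[of S] by blast
  have s0: "0 < s" using s u0 by (cases "s = 0") (auto simp: S_def)
  have "u s \<le> u 0"
  proof (rule DERIV_nonpos_imp_decreasing_open[where f = u])
    show "0 \<le> s" using s0 by simp
    show "continuous_on {0..s} u" by (rule continuous_on_subset[OF cont]) auto
    fix r assume r: "0 < r" "r < s"
    then have "r \<notin> S" using least by force
    then have "u r < c" using r s by (auto simp: S_def)
    then show "\<exists>y. (u has_real_derivative y) (at r) \<and> y \<le> 0" using der r by blast
  qed
  with u0 s show False by (simp add: S_def)
qed

lemma is_generator_H_at:
  assumes "is_generator_H \<phi> G" "0 < Im z" "0 < t"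
  shows "((\<lambda>s. \<phi> s z) has_vector_derivative G (\<phi> t z)) (at t)"
proof -
  have "((\<lambda>s. \<phi> s z) has_vector_derivative G (\<phi> t z)) (at t within {0..})"
    using assms by (simp add: is_generator_H_def upper_half_plane_def)
  moreover have "at t within {0..} = at t"
    by (rule at_within_open_subset[of t "{0<..}"]) (use \<open>0 < t\<close> in auto)
  ultimately show ?thesis by simp
qed

lemma is_generator_H_continuous_on:
  assumes "is_generator_H \<phi> G" "0 < Im z"
  shows "continuous_on {0..} (\<lambda>t. \<phi> t z)"
  using assms
  by (auto simp: is_generator_H_def upper_half_plane_def continuous_on_eq_continuous_within
      intro!: has_vector_derivative_continuous)

lemma is_semigroup_H_Im_pos:
  assumes "is_semigroup_H \<phi>" "0 \<le> t" "0 < Im z"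
  shows "0 < Im (\<phi> t z)"
  using assms by (auto simp: is_semigroup_H_def upper_half_plane_def)

text \<open>Along an orbit \<open>w\<close> in the cone, \<open>w\<^sup>2\<close> has derivative \<open>2 w G w\<close>, whose real part is
  negative far out; so \<open>Re (w\<^sup>2)\<close> stays below any sufficiently negative starting value,
  which confines the orbit to the cone.\<close>

lemma exists_orbit_in_cone:
  assumes sg: "is_semigroup_H \<phi>" and gen: "is_generator_H \<phi> G"
    and lim: "angular_lim_infty (\<lambda>z. z * G z) (of_real L)" and "L < 0"
  obtains z where "0 < Im z" "\<And>t. 0 \<le> t \<Longrightarrow> \<phi> t z \<in> cone_H 1"
proof -
  \<comment> \<open>The tolerance \<open>- L\<close> is just what makes \<open>Re (z * G z)\<close>
    negative.\<close>
  obtain R where R: "\<And>z. z \<in> cone_H 1 \<Longrightarrow> R \<le> cmod z \<Longrightarrow> cmod (z * G z - of_real L) < - L"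
    using angular_lim_inftyD[OF lim zero_less_one, of "- L"] \<open>L < 0\<close> by auto
  define z where "z = \<i> * of_real (\<bar>R\<bar> + 1)"
  have z: "0 < Im z" by (simp add: z_def)
  define w where "w t = \<phi> t z" for t
  define u where "u t = Re (w t * w t)" for t
  have wpos: "0 < Im (w t)" if "0 \<le> t" for t
    unfolding w_def by (rule is_semigroup_H_Im_pos[OF sg that z])
  \<comment> \<open>As \<open>u\<close> is the difference of the squares of \<open>Re\<close> and
    \<open>Im\<close>, the single barrier \<open>- R\<^sup>2\<close> controls both the slope and the
    modulus.\<close>
  have in_cone: "w t \<in> cone_H 1" and far: "R \<le> cmod (w t)" if "0 \<le> t" "u t < - R\<^sup>2" for t
  proof -
    have u: "u t = (Re (w t))\<^sup>2 - (Im (w t))\<^sup>2" by (simp add: u_def power2_eq_square)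
    have "0 \<le> R\<^sup>2" by simp
    with that(2) have "(Re (w t))\<^sup>2 \<le> (Im (w t))\<^sup>2" unfolding u by linarith
    then have "\<bar>Re (w t)\<bar> \<le> \<bar>Im (w t)\<bar>" by (simp add: abs_le_square_iff)
    then show "w t \<in> cone_H 1" using wpos[OF that(1)] by (simp add: cone_H_def)
    have "0 \<le> (Re (w t))\<^sup>2" by simp
    then have "R\<^sup>2 \<le> (cmod (w t))\<^sup>2" using that(2) unfolding u cmod_power2 by linarith
    then show "R \<le> cmod (w t)" by (rule power2_le_imp_le) simp
  qed
  have "u t < - R\<^sup>2" if "0 \<le> t" for t
  proof (rule less_barrier[OF _ _ _ that])
    show "continuous_on {0..} u"
      unfolding u_def w_def by (intro continuous_intros is_generator_H_continuous_on[OF gen z])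
    have "w 0 = z" using sg z by (simp add: w_def is_semigroup_H_def upper_half_plane_def)
    then have "u 0 = - (\<bar>R\<bar> + 1)\<^sup>2" by (simp add: u_def z_def power2_eq_square)
    moreover have "\<bar>R\<bar>\<^sup>2 < (\<bar>R\<bar> + 1)\<^sup>2" by (rule power_strict_mono) auto
    ultimately show "u 0 < - R\<^sup>2" by simp
  next
    fix t assume t: "0 < t" "u t < - R\<^sup>2"
    have "((\<lambda>t. w t * w t) has_vector_derivative w t * G (w t) + G (w t) * w t) (at t)"
      unfolding w_def by (intro has_vector_derivative_mult is_generator_H_at[OF gen z t(1)])
    then have "(u has_real_derivative Re (w t * G (w t) + G (w t) * w t)) (at t)"
      unfolding u_def has_real_derivative_iff_has_vector_derivative
      by (rule bounded_linear.has_vector_derivative[OF bounded_linear_Re])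
    moreover have "cmod (w t * G (w t) - of_real L) < - L"
      using in_cone far R t by simp
    then have "Re (w t * G (w t) - of_real L) < - L"
      using complex_Re_le_cmod le_less_trans by blast
    then have "Re (w t * G (w t) + G (w t) * w t) \<le> 0" by (simp add: mult.commute)
    ultimately show "\<exists>d\<le>0. (u has_real_derivative d) (at t)" by blast
  qed
  then show thesis using in_cone z by (intro that[of z]) (auto simp: w_def)
qed

text \<open>\<open>near\<close> bounds the hyperbolic distance of \<open>v\<close> and
  \<open>w\<close>. This makes \<open>Im w\<close> at most a multiple of \<open>Im v\<close>, hence
  also \<open>cmod (v - w)\<close>, and the slope of \<open>v\<close> is controlled by that of
  \<open>w\<close>.\<close>

lemma cone_H_of_hyperbolic_near:
  assumes v: "0 < Im v" and w: "w \<in> cone_H 1" and "0 \<le> M"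
    and near: "(cmod (v - w))\<^sup>2 \<le> M * (Im v * Im w)"
  shows "v \<in> cone_H (2 * (2 + 4 * M))"
proof -
  \<comment> \<open>The summands cover the two cases below: factor 2 when
    \<open>Im w \<le> 2 * Im v\<close>, factor \<open>4 * M\<close> otherwise.\<close>
  define C where "C = 2 + 4 * M"
  have C: "2 \<le> C" "4 * M \<le> C" using \<open>0 \<le> M\<close> by (simp_all add: C_def)
  have w0: "0 < Im w" using w by (rule Im_pos_of_cone_H)
  have "\<bar>Im v - Im w\<bar> \<le> cmod (v - w)" using abs_Im_le_cmod[of "v - w"] by simp
  have le: "Im w \<le> C * Im v"
  proof (cases "Im w \<le> 2 * Im v")
    case True
    also have "2 * Im v \<le> C * Im v" using C v by simp
    finally show ?thesis .
  next
    case False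
    then have "Im w / 2 \<le> cmod (v - w)" using \<open>\<bar>Im v - Im w\<bar> \<le> cmod (v - w)\<close> by linarith
    then have "(Im w / 2)\<^sup>2 \<le> (cmod (v - w))\<^sup>2" using w0 by (intro power_mono) auto
    with near have "Im w * Im w \<le> (4 * M * Im v) * Im w"
      by (simp add: power2_eq_square mult_ac)
    then have "Im w \<le> 4 * M * Im v" using w0 by simp
    also have "\<dots> \<le> C * Im v" using C v by simp
    finally show ?thesis .
  qed
  have "(cmod (v - w))\<^sup>2 \<le> M * (Im v * (C * Im v))"
    using near le v \<open>0 \<le> M\<close> by (meson mult_left_mono order_trans less_imp_le)
  also have "\<dots> \<le> C * (Im v * (C * Im v))"
    using C v \<open>0 \<le> M\<close> by (intro mult_right_mono) auto
  also have "\<dots> = (C * Im v)\<^sup>2" by (simp add: power2_eq_square)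
  finally have "cmod (v - w) \<le> C * Im v"
    by (rule power2_le_imp_le) (use C v in simp)
  moreover have "\<bar>Re v - Re w\<bar> \<le> cmod (v - w)" using abs_Re_le_cmod[of "v - w"] by simp
  moreover have "\<bar>Re w\<bar> \<le> Im w" using w by (simp add: cone_H_def)
  ultimately have "\<bar>Re v\<bar> \<le> C * Im v + C * Im v" using le by linarith
  then show ?thesis using v by (simp add: cone_H_def C_def algebra_simps)
qed

text \<open>One orbit in a cone suffices: by Schwarz--Pick the bound \<open>M\<close> between the
  starting points persists for all times, so the orbit of \<open>z\<close> stays in a cone whose
  slope does not depend on \<open>t\<close>.\<close>

lemma rate_of_angular_lim:
  assumes sg: "is_semigroup_H \<phi>" and gen: "is_generator_H \<phi> G"
    and dw: "non_elliptic_DW_infty \<phi>"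
    and lim: "angular_lim_infty (\<lambda>z. z * G z) (of_real L)" and "L < 0"
    and z: "0 < Im z"
  shows "((\<lambda>t. cmod (\<phi> t z) / sqrt t) \<longlongrightarrow> sqrt (- 2 * L)) at_top"
proof -
  obtain z0 where z0: "0 < Im z0" and cone: "\<And>t. 0 \<le> t \<Longrightarrow> \<phi> t z0 \<in> cone_H 1"
    using exists_orbit_in_cone[OF sg gen lim \<open>L < 0\<close>] by blast
  define M where "M = (cmod (z - z0))\<^sup>2 / (Im z * Im z0)"
  have M: "0 \<le> M" using z z0 by (simp add: M_def)
  show ?thesis
  proof (rule orbit_rate[OF _ _ _ _ lim \<open>L < 0\<close>])
    show "filterlim (\<lambda>t. \<phi> t z) at_infinity at_top"
      using dw z by (simp add: non_elliptic_DW_infty_def upper_half_plane_def)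
    show "0 < 2 * (2 + 4 * M)" using M by simp
    fix t :: real assume t: "0 \<le> t"
    have "(cmod (\<phi> t z - \<phi> t z0))\<^sup>2 * (Im z * Im z0)
        \<le> (cmod (z - z0))\<^sup>2 * (Im (\<phi> t z) * Im (\<phi> t z0))"
      using sg t is_semigroup_H_Im_pos[OF sg t]
      by (intro Schwarz_Pick_upper_half_plane z z0) (auto simp: is_semigroup_H_def)
    then have "(cmod (\<phi> t z - \<phi> t z0))\<^sup>2 \<le> M * (Im (\<phi> t z) * Im (\<phi> t z0))"
      using z z0 by (simp add: M_def pos_le_divide_eq)
    then show "\<phi> t z \<in> cone_H (2 * (2 + 4 * M))"
      by (rule cone_H_of_hyperbolic_near[OF is_semigroup_H_Im_pos[OF sg t z] cone[OF t] M])
  qed (rule is_generator_H_at[OF gen z])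
qed

section \<open>The imaginary part of the generator\<close>

text \<open>The Julia constant of \<open>\<phi> t\<close> is its angular derivative at infinity,
  which parabolicity makes equal to 1.\<close>

lemma parabolic_H_Im_le:
  assumes sg: "is_semigroup_H \<phi>" and par: "parabolic_H \<phi>" and t: "0 \<le> t" and z: "0 < Im z"
  shows "Im z \<le> Im (\<phi> t z)"
proof -
  have "\<phi> t holomorphic_on upper_half_plane" using sg t by (simp add: is_semigroup_H_def)
  then obtain a :: real where a: "\<And>z. 0 < Im z \<Longrightarrow> a * Im z \<le> Im (\<phi> t z)"
    and "angular_lim_infty (\<lambda>z. \<phi> t z / z) (of_real a)"
    using Julia_Wolff_Caratheodory is_semigroup_H_Im_pos[OF sg t] by blast
  moreover have "angular_lim_infty (\<lambda>z. \<phi> t z / z) 1"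
    using par t by (simp add: parabolic_H_def)
  ultimately have "(of_real a :: complex) = 1" using angular_lim_infty_unique by blast
  then show ?thesis using a[OF z] by simp
qed

lemma parabolic_H_Im_generator_nonneg:
  assumes sg: "is_semigroup_H \<phi>" and gen: "is_generator_H \<phi> G" and par: "parabolic_H \<phi>"
    and z: "0 < Im z"
  shows "0 \<le> Im (G z)"
proof -
  have \<phi>0: "\<phi> 0 z = z" using sg z by (simp add: is_semigroup_H_def upper_half_plane_def)
  have "((\<lambda>s. \<phi> s z) has_vector_derivative G (\<phi> 0 z)) (at 0 within {0..})"
    using gen z by (simp add: is_generator_H_def upper_half_plane_def)
  then have "((\<lambda>s. Im (\<phi> s z)) has_real_derivative Im (G z)) (at 0 within {0..})"
    unfolding has_real_derivative_iff_has_vector_derivative \<phi>0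
    by (rule bounded_linear.has_vector_derivative[OF bounded_linear_Im])
  then have "((\<lambda>s. (Im (\<phi> s z) - Im z) / s) \<longlongrightarrow> Im (G z)) (at_right 0)"
    by (simp add: has_field_derivative_iff \<phi>0 at_within_Ici_at_right)
  moreover have "eventually (\<lambda>s. 0 \<le> (Im (\<phi> s z) - Im z) / s) (at_right 0)"
    using parabolic_H_Im_le[OF sg par _ z]
    by (intro eventually_mono[OF eventually_at_right_less[of 0]]) simp
  ultimately show ?thesis by (rule tendsto_lowerbound) simp
qed

text \<open>A nonconstant \<open>f\<close> is open, so a real value would have values of
  \<open>f\<close> below the real axis next to it.\<close>

lemma Im_pos_or_constant:
  assumes hol: "f holomorphic_on upper_half_plane"
    and im: "\<And>z. 0 < Im z \<Longrightarrow> 0 \<le> Im (f z)"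
  shows "(\<forall>z. 0 < Im z \<longrightarrow> 0 < Im (f z)) \<or> f constant_on upper_half_plane"
proof (rule disjCI)
  assume nc: "\<not> f constant_on upper_half_plane"
  have op: "open (f ` upper_half_plane)"
    using open_mapping_thm[OF hol open_upper_half_plane convex_connected[OF convex_upper_half_plane]
        open_upper_half_plane order_refl nc] .
  show "\<forall>z. 0 < Im z \<longrightarrow> 0 < Im (f z)"
  proof (intro allI impI)
    fix z assume z: "0 < Im z"
    then have "f z \<in> f ` upper_half_plane" by (simp add: upper_half_plane_def)
    with op obtain e where e: "0 < e" "ball (f z) e \<subseteq> f ` upper_half_plane"
      by (meson open_contains_ball)
    have "f z - \<i> * of_real (e / 2) \<in> ball (f z) e"
      using e by (simp add: dist_norm norm_mult)
    then have "f z - \<i> * of_real (e / 2) \<in> f ` upper_half_plane" using e(2) by blast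
    then obtain w where "w \<in> upper_half_plane" "f w = f z - \<i> * of_real (e / 2)" by force
    then show "0 < Im (f z)" using im[of w] e by (simp add: upper_half_plane_def)
  qed
qed

text \<open>Excludes a constant generator \<open>c\<close>: the orbit of \<open>\<i>\<close> would
  be asymptotic to \<open>c * t\<close>, so growth of order \<open>sqrt t\<close> forces
  \<open>c = 0\<close>, and \<open>\<i>\<close> would be a fixed point.\<close>

lemma extremal_rate_Im_generator_pos:
  assumes sg: "is_semigroup_H \<phi>" and gen: "is_generator_H \<phi> G"
    and dw: "non_elliptic_DW_infty \<phi>" and par: "parabolic_H \<phi>"
    and rate: "((\<lambda>t. cmod (\<phi> t \<i>) / sqrt t) \<longlongrightarrow> L) at_top"
    and z: "0 < Im z"
  shows "0 < Im (G z)"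
proof (rule ccontr)
  assume "\<not> 0 < Im (G z)"
  moreover have "G holomorphic_on upper_half_plane" using gen by (simp add: is_generator_H_def)
  ultimately have "G constant_on upper_half_plane"
    using Im_pos_or_constant parabolic_H_Im_generator_nonneg[OF sg gen par] z by blast
  then obtain c where c: "\<And>z. 0 < Im z \<Longrightarrow> G z = c"
    by (auto simp: constant_on_def upper_half_plane_def)
  have i: "0 < Im \<i>" by simp
  have der: "((\<lambda>s. \<phi> s \<i>) has_vector_derivative c) (at t within {0..})" if "0 \<le> t" for t
    using gen that c[OF is_semigroup_H_Im_pos[OF sg that i]]
    by (auto simp: is_generator_H_def upper_half_plane_def)
  have "((\<lambda>t. \<phi> t \<i> / of_real t) \<longlongrightarrow> c) at_top"
    using is_generator_H_at[OF gen i] c[OF is_semigroup_H_Im_pos[OF sg _ i]]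
    by (intro tendsto_div_of_derivative_tendsto[where f' = "\<lambda>_. c"]) auto
  then have lim1: "((\<lambda>t. cmod (\<phi> t \<i> / of_real t)) \<longlongrightarrow> cmod c) at_top" by (rule tendsto_norm)
  have "((\<lambda>t. cmod (\<phi> t \<i>) / sqrt t * inverse (sqrt t)) \<longlongrightarrow> L * 0) at_top"
    by (intro tendsto_mult rate tendsto_inverse_0_at_top sqrt_at_top)
  moreover have "eventually (\<lambda>t. cmod (\<phi> t \<i>) / sqrt t * inverse (sqrt t) = cmod (\<phi> t \<i> / of_real t)) at_top"
    using eventually_gt_at_top[of 0]
    by eventually_elim (simp add: norm_divide divide_simps)
  ultimately have "((\<lambda>t. cmod (\<phi> t \<i> / of_real t)) \<longlongrightarrow> L * 0) at_top"
    by (rule Lim_transform_eventually)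
  with lim1 have "cmod c = L * 0"
    by (rule tendsto_unique[OF trivial_limit_at_top_linorder])
  then have "((\<lambda>s. \<phi> s \<i>) has_vector_derivative 0) (at t within {0..})" if "0 \<le> t" for t
    using der[OF that] by simp
  then have "\<exists>d. \<forall>t\<in>{0..}. \<phi> t \<i> = d"
    by (intro has_derivative_zero_constant) (auto simp: has_vector_derivative_def)
  then have "\<phi> 1 \<i> = \<phi> 0 \<i>" by (metis atLeast_iff order_refl zero_le_one)
  also have "\<phi> 0 \<i> = \<i>" using sg by (simp add: is_semigroup_H_def upper_half_plane_def)
  finally show False using dw by (auto simp: non_elliptic_DW_infty_def upper_half_plane_def)
qed

section \<open>Growth of the Koenigs function\<close>

text \<open>The derivative of \<open>Re h\<close> in the vertical direction is
  \<open>Re (\<i> * h')\<close>, that is, \<open>- Im h'\<close>.\<close>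

lemma Re_primitive_mono:
  assumes der: "\<And>z. 0 < Im z \<Longrightarrow> (h has_field_derivative h' z) (at z)"
    and im: "\<And>z. 0 < Im z \<Longrightarrow> Im (h' z) \<le> 0"
    and y: "0 < a" "a \<le> b"
  shows "Re (h (Complex x a)) \<le> Re (h (Complex x b))"
proof (rule DERIV_nonneg_imp_nondecreasing[OF y(2)])
  fix y assume "a \<le> y" "y \<le> b"
  then have y0: "0 < Im (Complex x y)" using y(1) by simp
  have "((\<lambda>y. of_real x + \<i> * of_real y) has_vector_derivative \<i>) (at y)"
    by (auto intro!: derivative_eq_intros simp: has_vector_derivative_def scaleR_conv_of_real)
  then have "((\<lambda>y. Complex x y) has_vector_derivative \<i>) (at y)"
    by (simp add: Complex_eq)
  then have "((h \<circ> (\<lambda>y. Complex x y)) has_vector_derivative \<i> * h' (Complex x y)) (at y)"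
    by (rule field_vector_diff_chain_at) (rule der[OF y0])
  then have "((\<lambda>y. Re (h (Complex x y))) has_real_derivative Re (\<i> * h' (Complex x y))) (at y)"
    unfolding has_real_derivative_iff_has_vector_derivative o_def
    by (rule bounded_linear.has_vector_derivative[OF bounded_linear_Re])
  moreover have "0 \<le> Re (\<i> * h' (Complex x y))" using im[OF y0] by simp
  ultimately show "\<exists>d. ((\<lambda>y. Re (h (Complex x y))) has_real_derivative d) (at y) \<and> 0 \<le> d"
    by blast
qed

text \<open>The bound has no angular restriction: by the previous lemma \<open>Re h\<close> at \<open>w\<close> is at most
  its value at the point of height \<open>cmod w\<close> above \<open>w\<close>, which lies in a fixed cone.\<close>

lemma Re_primitive_growth:
  assumes der: "\<And>z. 0 < Im z \<Longrightarrow> (h has_field_derivative h' z) (at z)"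
    and im: "\<And>z. 0 < Im z \<Longrightarrow> Im (h' z) \<le> 0"
    and lim: "angular_lim_infty (\<lambda>z. h' z / z) 0" and e: "0 < e"
  obtains C R where "\<And>w. 0 < Im w \<Longrightarrow> R \<le> cmod w \<Longrightarrow> Re (h w) \<le> C + e * (cmod w)\<^sup>2"
proof -
  \<comment> \<open>The factor 4 pays for two losses: \<open>cmod (q - b) \<le> 2 * cmod q\<close>
    and \<open>(cmod q)\<^sup>2 \<le> 2 * (cmod w)\<^sup>2\<close>.\<close>
  obtain R0 where R0: "\<And>z. z \<in> cone_H 1 \<Longrightarrow> R0 \<le> cmod z \<Longrightarrow> cmod (h' z / z - 0) < e / 4"
    using angular_lim_inftyD[OF lim zero_less_one, of "e / 4"] e by auto
  define R where "R = \<bar>R0\<bar> + 1"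
  define b where "b = Complex 0 R"
  have R: "0 < R" "R0 \<le> R" by (auto simp: R_def)
  show thesis
  proof (rule that[of R "cmod (h b)"])
    fix w assume w: "0 < Im w" "R \<le> cmod w"
    define q where "q = Complex (Re w) (cmod w)"
    \<comment> \<open>A convex piece of \<open>cone_H 1\<close> containing \<open>b\<close> and
      \<open>q\<close>, for the mean value estimate. The two inner products encode
      \<open>\<bar>Re z\<bar> \<le> Im z\<close>; the bound \<open>R \<le> Im z\<close> keeps
      \<open>S\<close> inside the half-plane and beyond radius \<open>R0\<close>.\<close>
    define S where "S = {z. R \<le> Im z} \<inter> {z. Complex 1 (-1) \<bullet> z \<le> 0}
        \<inter> {z. Complex (-1) (-1) \<bullet> z \<le> 0} \<inter> cball 0 (cmod q)"
    have S: "z \<in> S \<longleftrightarrow> R \<le> Im z \<and> \<bar>Re z\<bar> \<le> Im z \<and> cmod z \<le> cmod q" for z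
      by (auto simp: S_def inner_complex_def)
    have "Im w \<le> cmod w" "\<bar>Re w\<bar> \<le> cmod w"
      using abs_Im_le_cmod[of w] abs_Re_le_cmod[of w] by auto
    have wq: "cmod w \<le> cmod q" using abs_Im_le_cmod[of q] by (simp add: q_def)
    have "(Re w)\<^sup>2 \<le> (cmod w)\<^sup>2" by (simp add: cmod_power2)
    then have q2: "(cmod q)\<^sup>2 \<le> 2 * (cmod w)\<^sup>2"
      unfolding q_def cmod_power2[of "Complex _ _"] by simp
    have cb: "cmod b = R" using R by (simp add: b_def cmod_def)
    have "cmod (h q - h b) \<le> (e / 4 * cmod q) * cmod (q - b)"
    proof (rule field_differentiable_bound[of S h h'])
      show "convex S" unfolding S_def
        by (intro convex_Int convex_halfspace_le convex_halfspace_Im_ge convex_cball)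
      show "q \<in> S" using w \<open>\<bar>Re w\<bar> \<le> cmod w\<close> by (simp add: S) (simp add: q_def)
      show "b \<in> S" using w wq R cb by (simp add: S) (simp add: b_def)
    next
      fix z assume z: "z \<in> S"
      then have z0: "0 < Im z" using R by (simp add: S)
      then show "(h has_field_derivative h' z) (at z within S)"
        using der has_field_derivative_at_within by blast
      have "z \<in> cone_H 1" using z z0 by (simp add: S cone_H_def)
      moreover have "R0 \<le> cmod z" using z R abs_Im_le_cmod[of z] by (simp add: S)
      ultimately have "cmod (h' z) / cmod z < e / 4" using R0 by (simp add: norm_divide)
      moreover have "0 < cmod z" using z0 by auto
      ultimately have "cmod (h' z) \<le> e / 4 * cmod z" by (simp add: pos_divide_less_eq)
      also have "\<dots> \<le> e / 4 * cmod q" using z e by (simp add: S)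
      finally show "cmod (h' z) \<le> e / 4 * cmod q" .
    qed
    also have "\<dots> \<le> (e / 4 * cmod q) * (2 * cmod q)"
      using norm_triangle_ineq4[of q b] cb w wq e by (intro mult_left_mono) auto
    also have "\<dots> = e / 2 * (cmod q)\<^sup>2" by (simp add: power2_eq_square)
    also have "\<dots> \<le> e / 2 * (2 * (cmod w)\<^sup>2)" using q2 e by (intro mult_left_mono) auto
    finally have "cmod (h q - h b) \<le> e * (cmod w)\<^sup>2" by simp
    moreover have "Re (h q) \<le> cmod (h b) + cmod (h q - h b)"
      using complex_Re_le_cmod[of "h q"] norm_triangle_ineq2[of "h q" "h b"] by linarith
    moreover have "Re (h w) \<le> Re (h q)"
      using Re_primitive_mono[OF der im w(1) \<open>Im w \<le> cmod w\<close>, of "Re w"] by (simp add: q_def)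
    ultimately show "Re (h w) \<le> cmod (h b) + e * (cmod w)\<^sup>2" by linarith
  qed
qed

text \<open>The limit \<open>a\<close> of \<open>F z / z\<close> must be nonzero: with
  \<open>a = 0\<close>, \<open>Re h\<close> would be at most a small multiple of \<open>t\<close>
  along the orbit of \<open>\<i>\<close>, yet it is asymptotic to \<open>t\<close> there.\<close>

lemma angular_lim_of_extremal_rate:
  assumes sg: "is_semigroup_H \<phi>" and gen: "is_generator_H \<phi> G"
    and dw: "non_elliptic_DW_infty \<phi>" and par: "parabolic_H \<phi>"
    and rate: "((\<lambda>t. cmod (\<phi> t \<i>) / sqrt t) \<longlongrightarrow> L) at_top"
  obtains l :: real where "l < 0" "angular_lim_infty (\<lambda>z. z * G z) (of_real l)"
proof -
  have holG: "G holomorphic_on upper_half_plane" using gen by (simp add: is_generator_H_def)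
  have G: "0 < Im (G z)" if "0 < Im z" for z
    by (rule extremal_rate_Im_generator_pos[OF sg gen dw par rate that])
  then have G0: "G z \<noteq> 0" if "0 < Im z" for z using that by force
  define F where "F z = - inverse (G z)" for z
  have "Im (F z) = Im (G z) / (cmod (G z))\<^sup>2" for z
    by (simp add: F_def cmod_power2)
  then have F: "0 < Im (F z)" if "0 < Im z" for z
    using G[OF that] G0[OF that] by simp
  have "F holomorphic_on upper_half_plane"
    unfolding F_def by (intro holomorphic_intros holG) (auto simp: upper_half_plane_def G0)
  then obtain a :: real where a: "0 \<le> a" and lim: "angular_lim_infty (\<lambda>z. F z / z) (of_real a)"
    using Julia_Wolff_Caratheodory F by blast
  have "a \<noteq> 0"
  proof
    assume "a = 0"
    define h' where "h' z = inverse (G z)" for z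
    have holh': "h' holomorphic_on upper_half_plane"
      unfolding h'_def by (intro holomorphic_intros holG) (auto simp: upper_half_plane_def G0)
    obtain h where h: "\<And>z. 0 < Im z \<Longrightarrow> (h has_field_derivative h' z) (at z)"
    proof (rule holomorphic_convex_primitive'[OF convex_upper_half_plane open_upper_half_plane holh'])
      fix g assume "\<And>z. z \<in> upper_half_plane \<Longrightarrow> (g has_field_derivative h' z) (at z within upper_half_plane)"
      then have "\<And>z. 0 < Im z \<Longrightarrow> (g has_field_derivative h' z) (at z)"
        using at_within_open[OF _ open_upper_half_plane] by (simp add: upper_half_plane_def)
      then show thesis by (rule that)
    qed
    have imh: "Im (h' z) \<le> 0" if "0 < Im z" for z
      using F[OF that] by (simp add: F_def h'_def)
    have limh: "angular_lim_infty (\<lambda>z. h' z / z) 0"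
      using lim unfolding \<open>a = 0\<close> angular_lim_infty_iff_cone
      by (simp add: F_def h'_def tendsto_minus_cancel_left[of _ 0, symmetric])
    \<comment> \<open>Makes \<open>e * L\<^sup>2\<close> less than 1; the added 1 keeps the
      denominator positive even for \<open>L = 0\<close>.\<close>
    define e where "e = 1 / (2 * (L\<^sup>2 + 1))"
    have L1: "0 < L\<^sup>2 + 1" by (simp add: add_nonneg_pos)
    have "0 < e" using L1 by (simp add: e_def)
    then obtain C R where CR: "\<And>w. 0 < Im w \<Longrightarrow> R \<le> cmod w \<Longrightarrow> Re (h w) \<le> C + e * (cmod w)\<^sup>2"
      using Re_primitive_growth[OF h imh limh] by blast
    have i: "0 < Im \<i>" by simp
    define w where "w t = \<phi> t \<i>" for t
    have wpos: "0 < Im (w t)" if "0 \<le> t" for t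
      unfolding w_def by (rule is_semigroup_H_Im_pos[OF sg that i])
    \<comment> \<open>The Koenigs function linearizes the flow: \<open>h'\<close> is the reciprocal
      of \<open>G\<close>, so the chain rule gives speed 1.\<close>
    have "((\<lambda>t. h (w t)) has_vector_derivative 1) (at t)" if "0 < t" for t
    proof -
      have "((h \<circ> w) has_vector_derivative G (w t) * h' (w t)) (at t)"
        using is_generator_H_at[OF gen i that] h[OF wpos] that unfolding w_def
        by (intro field_vector_diff_chain_at) auto
      then show ?thesis using G0[OF wpos] that by (simp add: h'_def o_def)
    qed
    then have "((\<lambda>t. h (w t) / of_real t) \<longlongrightarrow> 1) at_top"
      by (intro tendsto_div_of_derivative_tendsto[where f' = "\<lambda>_. 1"]) auto
    then have lower: "((\<lambda>t. Re (h (w t) / of_real t)) \<longlongrightarrow> Re 1) at_top" by (rule tendsto_Re)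
    have upper: "((\<lambda>t. C / t + e * (cmod (w t) / sqrt t)\<^sup>2) \<longlongrightarrow> 0 + e * L\<^sup>2) at_top"
      using rate unfolding w_def
      by (intro tendsto_intros tendsto_divide_0[OF tendsto_const] filterlim_at_top_imp_at_infinity filterlim_ident)
    have "eventually (\<lambda>t. Re (h (w t) / of_real t) \<le> C / t + e * (cmod (w t) / sqrt t)\<^sup>2) at_top"
    proof -
      have "filterlim w at_infinity at_top"
        using dw by (simp add: w_def[abs_def] non_elliptic_DW_infty_def upper_half_plane_def)
      then have "eventually (\<lambda>t. R \<le> cmod (w t)) at_top"
        by (auto simp: filterlim_at_infinity_conv_norm_at_top filterlim_at_top)
      with eventually_gt_at_top[of 0] show ?thesis
      proof eventually_elim
        case (elim t)
        then have "Re (h (w t)) / t \<le> (C + e * (cmod (w t))\<^sup>2) / t"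
          using CR[OF wpos] by (intro divide_right_mono) auto
        with elim show ?case by (simp add: add_divide_distrib power_divide)
      qed
    qed
    with upper lower have "Re 1 \<le> 0 + e * L\<^sup>2"
      by (rule tendsto_le[OF trivial_limit_at_top_linorder])
    moreover have "e * L\<^sup>2 < 1" using L1 by (simp add: e_def divide_simps)
    ultimately show False by simp
  qed
  with a have "0 < a" by simp
  \<comment> \<open>By definition of \<open>F\<close>, \<open>z * G z\<close> is
    \<open>- inverse (F z / z)\<close>, and inversion is continuous at \<open>a > 0\<close>.\<close>
  have "angular_lim_infty (\<lambda>z. z * G z) (of_real (- inverse a))"
    unfolding angular_lim_infty_iff_cone
  proof (intro allI impI)
    fix k :: real assume "0 < k"
    then have "((\<lambda>z. F z / z) \<longlongrightarrow> of_real a) (inf at_infinity (principal (cone_H k)))"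
      using lim by (simp add: angular_lim_infty_iff_cone)
    then have "((\<lambda>z. - inverse (F z / z)) \<longlongrightarrow> - inverse (of_real a)) (inf at_infinity (principal (cone_H k)))"
      using \<open>0 < a\<close> by (intro tendsto_minus tendsto_inverse) auto
    then show "((\<lambda>z. z * G z) \<longlongrightarrow> of_real (- inverse a)) (inf at_infinity (principal (cone_H k)))"
      by (simp add: F_def field_simps)
  qed
  moreover have "- inverse a < 0" using \<open>0 < a\<close> by simp
  ultimately show thesis by (intro that)
qed

theorem theorem4p7:
  fixes \<phi> :: "real \<Rightarrow> complex \<Rightarrow> complex" and G :: "complex \<Rightarrow> complex"
  assumes "is_semigroup_H \<phi>"
    and "is_generator_H \<phi> G"
    and "non_elliptic_DW_infty \<phi>"
    and "parabolic_H \<phi>"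
    and "zero_hyperbolic_step \<phi>"
  shows "(extremal_rate \<phi> \<longleftrightarrow>
            (\<exists>L::real. L < 0 \<and> angular_lim_infty (\<lambda>z. z * G z) (complex_of_real L)))
       \<and> (\<forall>L::real. L < 0 \<and> angular_lim_infty (\<lambda>z. z * G z) (complex_of_real L) \<longrightarrow>
            (\<forall>z\<in>upper_half_plane.
               ((\<lambda>t. cmod (\<phi> t z) / sqrt t) \<longlongrightarrow> sqrt (- 2 * L)) at_top))"
proof -
  have rate: "((\<lambda>t. cmod (\<phi> t z) / sqrt t) \<longlongrightarrow> sqrt (- 2 * L)) at_top"
    if "L < 0" "angular_lim_infty (\<lambda>z. z * G z) (complex_of_real L)" "z \<in> upper_half_plane" for L z
    using rate_of_angular_lim[OF assms(1-3) that(2,1)] that(3) by (simp add: upper_half_plane_def)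
  have "\<exists>L::real. L < 0 \<and> angular_lim_infty (\<lambda>z. z * G z) (complex_of_real L)"
    if ext: "extremal_rate \<phi>"
  proof -
    have "\<i> \<in> upper_half_plane" by (simp add: upper_half_plane_def)
    then obtain L where "((\<lambda>t. cmod (\<phi> t \<i>) / sqrt t) \<longlongrightarrow> L) at_top"
      using ext unfolding extremal_rate_def by blast
    then show ?thesis using angular_lim_of_extremal_rate[OF assms(1-4)] by blast
  qed
  moreover have "extremal_rate \<phi>"
    if "L < 0" "angular_lim_infty (\<lambda>z. z * G z) (complex_of_real L)" for L
    unfolding extremal_rate_def
    using rate[OF that] that(1) by (intro exI[of _ "sqrt (- 2 * L)"]) simp
  ultimately show ?thesis using rate by blast
qed

end
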